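(* Let $G$ be the finite Coxeter group $B_n$ or the finite Coxeter group $D_n$, and let $C=\bigcup_i C_i$ be a union of conjugacy classes of $G$. Then the conjugation quandle $\mathrm{Conj}(G,C)$ satisfies the Hayashi property.
   Context: Let $C_2=\{\pm1\}$. The symmetric group $S_n$ acts on $(C_2)^n$ by $\pi.(a_1,\dots,a_n)=(a_{\pi^{-1}(1)},\dots,a_{\pi^{-1}(n)})$, and the wreath product $C_2\wr S_n$ is the corresponding semidirect product: its elements are pairs $((a_1,\dots,a_n);\pi)$, with product $((a_1,\dots,a_n);\pi)\,((b_1,\dots,b_n);\sigma)=((a_1b_{\pi^{-1}(1)},\dots,a_nb_{\pi^{-1}(n)});\pi\sigma)$. The Coxeter group $B_n$ (isomorphic to $C_n$) is $C_2\wr S_n$, and $D_n$ is its index-two subgroup $\{((a_1,\dots,a_n);\pi)\mid \prod_{i=1}^n a_i=1,\ \pi\in S_n\}$. For a group $G$ and a conjugation-closed subset $C\subseteq G$, the conjugation quandle $\mathrm{Conj}(G,C)$ is the set $C$ with the binary operation $x\triangleright y=yxy^{-1}$. For $y\in C$ the right translation is the permutation $R_y:C\to C$, $R_y(x)=x\triangleright y=yxy^{-1}$. A permutation of a finite set whose disjoint cycles (fixed points included as cycles of length $1$) have the distinct lengths $\lambda_1<\lambda_2<\dots<\lambda_t$ is called regular if $\lambda_i$ divides $\lambda_t$ for all $1\le i\le t$. A finite quandle satisfies the Hayashi property if all of its right translations are regular permutations. *)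

theory Defs
  imports "HOL-Algebra.Sym_Groups" "HOL-Combinatorics.Orbits"
begin

section \<open>The Coxeter groups of types B and D\<close>

text \<open>Elements of $(C_2)^n$ are extensional functions on \<open>{1..n}\<close>, so that the carrier is finite
  and equality of elements is equality of functions. Permutations compose from right to left.\<close>

definition sign_vectors :: "nat \<Rightarrow> (nat \<Rightarrow> int) set" where
  "sign_vectors n = {1..n} \<rightarrow>\<^sub>E {1, -1}"

definition wreath_C2 :: "nat \<Rightarrow> ((nat \<Rightarrow> int) \<times> (nat \<Rightarrow> nat)) monoid" where
  "wreath_C2 n =
    \<lparr> carrier = sign_vectors n \<times> carrier (sym_group n),
      mult = (\<lambda>(a, \<pi>) (b, \<sigma>). (\<lambda>i\<in>{1..n}. a i * b (inv' \<pi> i), \<pi> \<otimes>\<^bsub>sym_group n\<^esub> \<sigma>)),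
      one = (\<lambda>i\<in>{1..n}. 1, \<one>\<^bsub>sym_group n\<^esub>) \<rparr>"

definition coxeter_B :: "nat \<Rightarrow> ((nat \<Rightarrow> int) \<times> (nat \<Rightarrow> nat)) monoid" where
  "coxeter_B n = wreath_C2 n"

definition coxeter_D :: "nat \<Rightarrow> ((nat \<Rightarrow> int) \<times> (nat \<Rightarrow> nat)) monoid" where
  "coxeter_D n =
    (coxeter_B n) \<lparr> carrier := {(a, \<pi>) \<in> carrier (coxeter_B n). (\<Prod>i=1..n. a i) = 1} \<rparr>"


section \<open>Conjugacy classes\<close>

definition conjugacy_class :: "('a, 'b) monoid_scheme \<Rightarrow> 'a \<Rightarrow> 'a set" where
  "conjugacy_class G x = {g \<otimes>\<^bsub>G\<^esub> x \<otimes>\<^bsub>G\<^esub> inv\<^bsub>G\<^esub> g | g. g \<in> carrier G}"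

definition conjugacy_classes :: "('a, 'b) monoid_scheme \<Rightarrow> 'a set set" where
  "conjugacy_classes G = conjugacy_class G ` carrier G"


section \<open>Quandles\<close>

record 'a quandle = "'a partial_object" +
  qop :: "'a \<Rightarrow> 'a \<Rightarrow> 'a" (infixl \<open>\<triangleright>\<index>\<close> 70)

text \<open>Right quandles: the right translations $x \mapsto x \triangleright y$ are the automorphisms.\<close>

locale quandle =
  fixes Q (structure)
  assumes idem: "x \<in> carrier Q \<Longrightarrow> x \<triangleright> x = x"
    and translation_bij: "y \<in> carrier Q \<Longrightarrow> bij_betw (\<lambda>x. x \<triangleright> y) (carrier Q) (carrier Q)"
    and self_distrib: "\<lbrakk> x \<in> carrier Q; y \<in> carrier Q; z \<in> carrier Q \<rbrakk> \<Longrightarrow>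
      (x \<triangleright> y) \<triangleright> z = (x \<triangleright> z) \<triangleright> (y \<triangleright> z)"

text \<open>The right translation is extended by the identity outside the carrier, as required by
  \<^const>\<open>permutes\<close>.\<close>

definition right_translation :: "('a, 'b) quandle_scheme \<Rightarrow> 'a \<Rightarrow> 'a \<Rightarrow> 'a" where
  "right_translation Q y = perm_restrict (\<lambda>x. x \<triangleright>\<^bsub>Q\<^esub> y) (carrier Q)"

definition conj_quandle :: "('a, 'b) monoid_scheme \<Rightarrow> 'a set \<Rightarrow> 'a quandle" where
  "conj_quandle G C = \<lparr> carrier = C, qop = (\<lambda>x y. y \<otimes>\<^bsub>G\<^esub> x \<otimes>\<^bsub>G\<^esub> inv\<^bsub>G\<^esub> y) \<rparr>"


section \<open>Regular permutations and the Hayashi property\<close>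

text \<open>The supports of the disjoint cycles of a permutation of \<open>S\<close>, fixed points included, are the
  orbits of the elements of \<open>S\<close>.\<close>

definition cycle_lengths :: "'a set \<Rightarrow> ('a \<Rightarrow> 'a) \<Rightarrow> nat set" where
  "cycle_lengths S f = (\<lambda>x. card (Orbits.orbit f x)) ` S"

text \<open>On the empty set there are no cycles, and the divisibility condition is vacuous.\<close>

definition regular_permutation :: "'a set \<Rightarrow> ('a \<Rightarrow> 'a) \<Rightarrow> bool" where
  "regular_permutation S f \<longleftrightarrow> finite S \<and> f permutes S \<and>
    (\<forall>l \<in> cycle_lengths S f. l dvd Max (cycle_lengths S f))"

definition hayashi :: "('a, 'b) quandle_scheme \<Rightarrow> bool" where
  "hayashi Q \<longleftrightarrow> quandle Q \<and> finite (carrier Q) \<and>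
    (\<forall>y \<in> carrier Q. regular_permutation (carrier Q) (right_translation Q y))"

end

theory Submission
  imports Defs "HOL-Algebra.Multiplicative_Group" "HOL-Computational_Algebra.Primes"
begin

text \<open>A right translation by \<open>y = (a; w)\<close> is regular as soon as some \<open>x\<close> in the quandle has the
  property that every power of \<open>y\<close> commuting with \<open>x\<close> is central in the group: the cycle of \<open>x\<close> then has
  the order of the translation as its length. It is also regular if its order is a prime power, which
  covers the cases \<open>w\<^sup>2 = 1\<close> and \<open>w\<close> a 3-cycle on three points. Otherwise \<open>w\<close> has a conjugate
  \<open>v = t w t\<^sup>-\<^sup>1\<close> commuting with no nontrivial power of \<open>w\<close>, and the conjugate \<open>x\<close> of \<open>y\<close> by the
  permutation \<open>t\<close> with trivial signs (an element of both groups) projects to \<open>v\<close>. Hence a power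
  of \<open>y\<close> commuting with \<open>x\<close> is a sign vector. For \<open>d\<close> the order of \<open>w\<close>, this power is trivial or equal to
  \<open>y\<^sup>d = (s; 1)\<close>; choosing \<open>t\<close> such that \<open>v\<close> links two \<open>w\<close>-orbits on which \<open>s\<close> differs, if there
  are any, forces it to be constant, hence central.\<close>

section \<open>Conjugates of a permutation that avoid its powers\<close>

text \<open>The permutation built is one cycle through \<open>T\<close>, of which only the
  properties used later are recorded. A new point \<open>c\<close> is inserted just before
  \<open>a\<close>, so that \<open>t a = b\<close> survives.\<close>

lemma exists_long_cycle:
  assumes "finite T" "a \<in> T" "b \<in> T" "a \<noteq> b"
  shows "\<exists>t. t permutes T \<and> t a = b \<and> (\<forall>x\<in>T. t x \<noteq> x) \<and> (\<forall>x\<in>T. t (t x) = x \<longrightarrow> T = {x, t x})"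
proof -
  have "\<exists>t. t permutes ({a, b} \<union> U) \<and> t a = b \<and> (\<forall>x\<in>{a, b} \<union> U. t x \<noteq> x) \<and>
      (\<forall>x\<in>{a, b} \<union> U. t (t x) = x \<longrightarrow> {a, b} \<union> U = {x, t x})"
    if "finite U" "U \<inter> {a, b} = {}" for U
    using that
  proof (induction U)
    case empty
    show ?case
      using \<open>a \<noteq> b\<close> by (intro exI[of _ "transpose a b"]) (auto simp: permutes_swap_id)
  next
    case (insert c U)
    let ?T = "{a, b} \<union> U"
    obtain t where t: "t permutes ?T" "t a = b" "\<forall>x\<in>?T. t x \<noteq> x"
      "\<forall>x\<in>?T. t (t x) = x \<longrightarrow> ?T = {x, t x}"
      using insert by auto
    have c: "c \<notin> ?T" using insert by auto
    then have tc: "t c = c" using t(1) by (simp add: permutes_not_in)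
    have tin: "t x \<in> ?T \<longleftrightarrow> x \<in> ?T" for x using t(1) by (rule permutes_in_image)
    define t' where "t' = transpose a c \<circ> t"
    have inj: "t x = t y \<longleftrightarrow> x = y" for x y using permutes_inj[OF t(1)] by (auto dest: injD)
    have t'c: "t' c = a" and t'a: "t' a = b"
      using tc t(2) \<open>a \<noteq> b\<close> c by (auto simp: t'_def transpose_def)
    have 1: "t' permutes insert c ?T"
      unfolding t'_def
      by (intro permutes_compose permutes_swap_id permutes_subset[OF t(1)]) auto
    have t'x: "t' x = (if t x = a then c else t x)" if "x \<in> ?T" for x
      using that c tin[of x] by (auto simp: t'_def transpose_def)
    have 2: "t' x \<noteq> x" if "x \<in> insert c ?T" for x
      using that t'c t'x c t(3) by (cases "x = c") auto
    have 3: "t' (t' x) \<noteq> x" if "x \<in> insert c ?T" for x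
    proof (cases "x = c")
      case True
      then show ?thesis using t'c t'a c by auto
    next
      case False
      then have x: "x \<in> ?T" using that by auto
      show ?thesis
      proof
        \<comment> \<open>Once passing through \<open>c\<close> is ruled out, 2-periodicity is
          inherited from \<open>t\<close>; then the old cycle is \<open>(a b)\<close> and the new
          one has length three.\<close>
        assume eq: "t' (t' x) = x"
        have tx: "t x \<noteq> a"
          using eq t'x[OF x] t'c t(3) x by (auto split: if_splits)
        then have "t (t x) = x"
          using eq t'x[OF x] t'x[of "t x"] tin[of x] x c by (auto split: if_splits)
        then have T: "?T = {x, t x}" using t(4) x by blast
        have "a \<in> ?T" by simp
        then have "x = a" unfolding T using tx by simp
        then have "t' x = b" "t b = a"
          using t(2) \<open>t (t x) = x\<close> \<open>a \<noteq> b\<close> t'a by auto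
        then show False using eq t'x[of b] c \<open>x = a\<close> by auto
      qed
    qed
    show ?case
      using 1 2 3 t'a by (intro exI[of _ t']) (simp add: insert_commute)
  qed
  from this[of "T - {a, b}"] assms show ?thesis
    by (simp add: insert_absorb Un_absorb1 insert_Diff_if)
qed

lemma permutes_orbit_eq:
  assumes "f permutes S" "finite S" "y \<in> orbit f x"
  shows "orbit f y = orbit f x"
  using orbit_cyclic_eq3[OF cyclic_on_orbit[OF assms(1,2)] assms(3)] .

lemma permutes_self_in_orbit:
  assumes "f permutes S" "finite S"
  shows "x \<in> orbit f x"
  using assms permutation_self_in_orbit permutation_permutes by metis

lemma fixes_orbit:
  assumes "y \<in> orbit f x" "g x = x" "\<And>z. g (f z) = f (g z)"
  shows "g y = y"
  using assms(1) by induction (simp_all add: assms(2,3))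

lemma exists_transversal:
  assumes S: "finite S" "w permutes S" and ab: "a \<in> S" "b \<in> S" "b \<notin> orbit w a"
  obtains T where "T \<subseteq> S" "a \<in> T" "b \<in> T" "\<And>x. x \<in> S \<Longrightarrow> \<exists>y\<in>T. x \<in> orbit w y"
    "\<And>x y. x \<in> T \<Longrightarrow> y \<in> T \<Longrightarrow> y \<in> orbit w x \<Longrightarrow> y = x"
proof -
  have self: "x \<in> orbit w x" for x
    using permutes_self_in_orbit S(1,2) by metis
  note eqI = permutes_orbit_eq[OF S(2,1)]
  \<comment> \<open>The representative of an orbit is \<open>a\<close> or \<open>b\<close> if
    available; as these lie in different orbits, both are chosen.\<close>
  define r where "r A = (if a \<in> A then a else if b \<in> A then b else SOME z. z \<in> A)" for A
  have r: "r (orbit w x) \<in> orbit w x" for x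
    using someI[of "\<lambda>z. z \<in> orbit w x", OF self] by (simp add: r_def)
  let ?T = "(\<lambda>x. r (orbit w x)) ` S"
  show thesis
  proof
    show "?T \<subseteq> S" using r permutes_orbit_subset[OF S(2)] by blast
    have "r (orbit w a) = a" by (simp add: r_def self)
    then show "a \<in> ?T" using ab by force
    have "a \<notin> orbit w b" using eqI[of a b] ab self by blast
    then have "r (orbit w b) = b" by (simp add: r_def self)
    then show "b \<in> ?T" using ab by force
    show "\<exists>y\<in>?T. x \<in> orbit w y" if "x \<in> S" for x
      using that eqI[OF r[of x]] self by blast
    show "y = x" if "x \<in> ?T" "y \<in> ?T" "y \<in> orbit w x" for x y
      using that eqI r by (smt (verit) imageE)
  qed
qed

text \<open>Let \<open>t\<close> be a cycle through a transversal of the orbits of \<open>w\<close>. A cycle of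
  \<^term>\<open>t \<circ> w \<circ> Hilbert_Choice.inv t\<close> is a cycle of \<open>w\<close> with its representative \<open>x\<close> replaced by
  \<^term>\<open>t x\<close>, so a power of \<open>w\<close>, which preserves each orbit of \<open>w\<close>, can only permute these cycles if
  it fixes every \<open>x\<close>. The sole exception is that \<open>w\<close> consists of two transpositions.\<close>

lemma conjugate_avoiding_powers_intransitive:
  assumes S: "finite S" "w permutes S" and w2: "w \<circ> w \<noteq> id"
    and ab: "a \<in> S" "b \<in> S" "b \<notin> orbit w a" "w a \<noteq> a"
  shows "\<exists>t. t permutes S \<and> (\<forall>v. v \<circ> t = t \<circ> w \<longrightarrow> v (inv' w a) = b \<and>
    (\<forall>k. (w ^^ k) \<circ> v = v \<circ> (w ^^ k) \<longrightarrow> w ^^ k = id))"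
proof -
  have self: "x \<in> orbit w x" for x
    using permutes_self_in_orbit S(1,2) by metis
  note eqI = permutes_orbit_eq[OF S(2,1)]
  obtain T where T: "T \<subseteq> S" "a \<in> T" "b \<in> T" "\<And>x. x \<in> S \<Longrightarrow> \<exists>y\<in>T. x \<in> orbit w y"
    and uniq: "\<And>x y. x \<in> T \<Longrightarrow> y \<in> T \<Longrightarrow> y \<in> orbit w x \<Longrightarrow> y = x"
    using exists_transversal[OF S ab(1-3)] by metis
  have "a \<noteq> b" using ab(3) self by auto
  then obtain t where t: "t permutes T" "t a = b" and tne: "\<And>x. x \<in> T \<Longrightarrow> t x \<noteq> x"
    and t2: "\<And>x. x \<in> T \<Longrightarrow> t (t x) = x \<Longrightarrow> T = {x, t x}"
    using exists_long_cycle[of T a b] T finite_subset[OF T(1) S(1)] by metis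
  have tin: "t x \<in> T \<longleftrightarrow> x \<in> T" for x using t(1) by (rule permutes_in_image)
  have tid: "t x = x" if "x \<notin> T" for x using t(1) that by (rule permutes_not_in)
  have winj: "w x = w y \<longleftrightarrow> x = y" for x y using permutes_inj[OF S(2)] by (auto dest: injD)
  have winv: "w (inv' w x) = x" for x using S(2) by (simp add: permutes_inverses)
  have worb: "w x \<in> orbit w x" for x by (rule orbit.base)
  have linv: "inv' w x \<in> orbit w x" for x
    using eqI[OF worb[of "inv' w x"]] self[of "inv' w x"] winv by simp
  \<comment> \<open>A map commuting with \<open>w\<close> is determined by its values on a
    transversal; used below for \<open>w \<circ> w\<close> and for a power of
    \<open>w\<close>.\<close>
  have all: "f = id" if f: "\<And>x. x \<in> T \<Longrightarrow> f x = x" "\<And>x. x \<notin> S \<Longrightarrow> f x = x"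
    "\<And>x. f (w x) = w (f x)" for f
  proof
    fix x
    show "f x = id x"
    proof (cases "x \<in> S")
      case True
      then obtain y where "y \<in> T" "x \<in> orbit w y" using T(4) by blast
      then show ?thesis using fixes_orbit[of x w y f] f by simp
    qed (use f in simp)
  qed
  have wout: "w x = x" if "x \<notin> S" for x using that S(2) by (simp add: permutes_not_in)
  show ?thesis
  proof (intro exI[of _ t] conjI allI impI)
    show "t permutes S" using permutes_subset[OF t(1) T(1)] .
    \<comment> \<open>The equation says that \<open>v\<close> is the conjugate of \<open>w\<close>
      by \<open>t\<close>.\<close>
    fix v assume "v \<circ> t = t \<circ> w"
    then have vt: "v (t x) = t (w x)" for x by (metis comp_apply)
    then have vn: "v x = t (w x)" if "x \<notin> T" for x using tid[OF that] by metis
    \<comment> \<open>Since \<open>w\<close> moves \<open>a\<close>, the predecessor of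
      \<open>a\<close> is off the transversal, where \<open>v\<close> is \<open>t\<close> after
      \<open>w\<close>.\<close>
    have "inv' w a \<notin> T" using uniq[of a "inv' w a"] T linv winv ab(4) by metis
    then show "v (inv' w a) = b" using vn winv t(2) by simp
    fix k assume comm: "(w ^^ k) \<circ> v = v \<circ> (w ^^ k)"
    define z where "z = w ^^ k"
    have zv: "z (v x) = v (z x)" for x using comm unfolding z_def by (metis comp_apply)
    have zw: "z (w x) = w (z x)" for x unfolding z_def by (simp add: funpow_swap1)
    have zorb: "z x \<in> orbit w x" for x unfolding z_def by (rule funpow_in_orbit[OF self])
    have zinj: "z x = z y \<longleftrightarrow> x = y" for x y
      unfolding z_def using inj_fn[OF permutes_inj[OF S(2)], of k] by (auto dest: injD)
    have zout: "z x = x" if "x \<notin> S" for x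
      unfolding z_def using wout[OF that] by (induction k) auto
    have moved: "z x = w x \<and> w (w x) = x \<and> T = {x, t x} \<and> z (t x) \<noteq> t x" if x: "x \<in> T" "z x \<noteq> x" for x
    proof -
      have notin: "y \<notin> T" if "y \<in> orbit w x" "y \<noteq> x" for y using uniq that x by blast
      have txo: "t x \<notin> orbit w x" using uniq x tne tin by blast
      have wx: "w x \<noteq> x"
      proof
        assume "w x = x"
        then have "(w ^^ j) x = x" for j by (induction j) auto
        then show False using x z_def by simp
      qed
      \<comment> \<open>At \<open>?l\<close>, the map \<open>v\<close> leaves the orbit of
        \<open>x\<close> for \<open>t x\<close>. Were \<open>z ?l\<close> not \<open>x\<close>,
        \<open>v\<close> would map it to \<open>z x\<close>, and commutation would give
        \<open>z (t x) = z x\<close>.\<close>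
      let ?l = "inv' w x"
      have l: "?l \<notin> T" using notin[OF linv] winv wx by metis
      have vl: "v ?l = t x" using vn[OF l] winv by simp
      have zl: "z ?l = x"
      proof (rule ccontr)
        assume "z ?l \<noteq> x"
        moreover have "z ?l \<in> orbit w x" using zorb[of ?l] eqI[OF linv] by simp
        ultimately have "v (z ?l) = t (z x)" using vn notin zw winv by metis
        also have "\<dots> = z x" using tid notin zorb x(2) by blast
        finally have "z (t x) = z x" using zv vl by metis
        then show False using zinj tne x by blast
      qed
      then have zx: "z x = w x" using zw[of ?l] winv by simp
      have vx: "v x = z (t x)" using zv[of ?l] zl vl by simp
      have ww: "w (w x) = x"
      proof (rule ccontr)
        assume w2x: "w (w x) \<noteq> x"
        \<comment> \<open>As \<open>w x\<close> and \<open>w (w x)\<close> are off \<open>T\<close>,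
          only \<open>w x\<close> is sent to \<open>w (w x)\<close> by \<open>v\<close>; but
          commutation sends \<open>z (t x)\<close> there too, from another orbit.\<close>
        have wwo: "w (w x) \<in> orbit w x" by (intro orbit.step worb)
        have "v (t x) = w x" using vt tid notin[OF worb wx] by simp
        then have vq: "v (z (t x)) = w (w x)" using zv[of "t x"] zw zx by simp
        show False
        proof (cases "z (t x) \<in> T")
          case True
          then have "z (t x) = t x" using uniq zorb x(1) tin by blast
          then have "w x = w (w x)" using vq \<open>v (t x) = w x\<close> by simp
          then show False using winj wx by metis
        next
          case False
          then have "t (w (z (t x))) = w (w x)" using vq vn by simp
          moreover have "w (w x) \<notin> T" using notin wwo w2x by blast
          ultimately have "w (z (t x)) = w (w x)" using tin tid by metis
          then have "w x \<in> orbit w (t x)" using winj zorb[of "t x"] by metis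
          then have "orbit w x = orbit w (t x)" using eqI worb by metis
          then show False using txo self[of "t x"] by simp
        qed
      qed
      \<comment> \<open>Let \<open>u\<close> precede \<open>x\<close> under \<open>t\<close>. From
        \<open>z (t x) = v x = t (w u)\<close> it follows that \<open>u\<close> and
        \<open>t x\<close> represent the same orbit, so \<open>t\<close> is 2-periodic at
        \<open>x\<close>.\<close>
      obtain u where u: "t u = x" "u \<in> T"
        using t(1) x(1) tin by (metis permutes_inverses(1))
      have ztx: "z (t x) = t (w u)" using vx vt[of u] u by simp
      have wu: "w u \<noteq> u"
      proof
        assume "w u = u"
        then have "x \<in> orbit w (t x)" using ztx u zorb[of "t x"] by simp
        then show False using txo eqI[of x "t x"] self[of "t x"] by simp
      qed
      then have "w u \<notin> T" using uniq[OF u(2)] worb by blast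
      then have ztx': "z (t x) = w u" using ztx tid by simp
      then have "orbit w u = orbit w (t x)" using eqI worb[of u] zorb[of "t x"] by metis
      then have "u = t x" using uniq u x(1) tin self by metis
      then show ?thesis using zx ww t2[OF x(1)] u ztx' wu by simp
    qed
    have "z x = x" if x: "x \<in> T" for x
    proof (rule ccontr)
      assume zx: "z x \<noteq> x"
      \<comment> \<open>\<open>moved\<close> applies to both representatives \<open>x\<close> and
        \<open>t x\<close>, so all orbits have at most two points.\<close>
      have m: "w (w y) = y" if "y \<in> T" for y
        using moved[OF x zx] moved[of "t x"] x tin that by auto
      have "w \<circ> w = id"
        by (rule all) (use m wout in auto)
      with w2 show False by simp
    qed
    then have "z = id" using all zout zw by blast
    then show "w ^^ k = id" by (simp add: z_def)
  qed
qed

text \<open>For \<open>t = (i w(i))\<close> and \<open>v = t w t\<^sup>-\<^sup>1\<close>, the point \<open>w(i)\<close> is the only one with \<open>w(v(x)) = x\<close>,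
  so a permutation commuting with \<open>v\<close> and \<open>w\<close> fixes it.\<close>

lemma conjugate_avoiding_powers_transitive:
  assumes S: "finite S" "w permutes S" "S = orbit w i" and w2: "w \<circ> w \<noteq> id" and w3: "w \<circ> w \<circ> w \<noteq> id"
  shows "\<exists>t. t permutes S \<and> (\<forall>v. v \<circ> t = t \<circ> w \<longrightarrow>
    (\<forall>k. (w ^^ k) \<circ> v = v \<circ> (w ^^ k) \<longrightarrow> w ^^ k = id))"
proof -
  have iS: "i \<in> S"
    using permutes_self_in_orbit[OF S(2,1), of i] S(3) by simp
  have winj: "w x = w y \<longleftrightarrow> x = y" for x y using permutes_inj[OF S(2)] by (auto dest: injD)
  have wout: "w x = x" if "x \<notin> S" for x using that S(2) by (simp add: permutes_not_in)
  have all: "f = id" if f: "f x = x" "x \<in> S" "\<And>x. x \<notin> S \<Longrightarrow> f x = x" "\<And>x. f (w x) = w (f x)" for f x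
  proof
    fix y
    have "S = orbit w x" using permutes_orbit_eq[OF S(2,1)] S(3) f(2) by metis
    then show "f y = id y" using fixes_orbit[of y w x f] f(1,3,4) by (cases "y \<in> S") simp_all
  qed
  have w2x: "w (w x) \<noteq> x" if "x \<in> S" for x
  proof
    assume "w (w x) = x"
    then have "w \<circ> w = id" using that by (intro all[of _ x]) (simp_all add: wout)
    then show False using w2 by simp
  qed
  then have w1x: "w x \<noteq> x" if "x \<in> S" for x using that by metis
  have w3x: "w (w (w x)) \<noteq> x" if "x \<in> S" for x
  proof
    assume "w (w (w x)) = x"
    then have "w \<circ> w \<circ> w = id" using that by (intro all[of _ x]) (simp_all add: wout)
    then show False using w3 by simp
  qed
  define j where "j = w i"
  have jS: "j \<in> S" using iS S(2) by (simp add: j_def permutes_in_image)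
  define t where "t = transpose i j"
  have tt: "t (t x) = x" for x by (simp add: t_def)
  show ?thesis
  proof (intro exI[of _ t] conjI allI impI)
    show "t permutes S" unfolding t_def using iS jS by (rule permutes_swap_id)
    fix v k assume "v \<circ> t = t \<circ> w" and comm: "(w ^^ k) \<circ> v = v \<circ> (w ^^ k)"
    then have v: "v x = t (w (t x))" for x using tt by (metis comp_apply)
    define z where "z = w ^^ k"
    have zv: "z (v x) = v (z x)" for x using comm unfolding z_def by (metis comp_apply)
    have zw: "z (w x) = w (z x)" for x unfolding z_def by (simp add: funpow_swap1)
    have zout: "z x = x" if "x \<notin> S" for x
      unfolding z_def using wout[OF that] by (induction k) auto
    have zS: "z j \<in> S" using jS S(2) by (simp add: z_def permutes_in_funpow_image)
    have "w (v j) = j" by (simp add: v t_def j_def[symmetric])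
    then have wvz: "w (v (z j)) = z j" using zv zw by metis
    have "z j = j"
    proof (rule ccontr)
      \<comment> \<open>A second solution of \<open>w (v y) = y\<close> in \<open>S\<close> would be
        a fixed point of the square or the cube of \<open>w\<close>.\<close>
      assume zj: "z j \<noteq> j"
      show False
      proof (cases "z j = i")
        case True
        have "w j \<noteq> j" "w j \<noteq> i" using w1x[OF jS] w2x[OF iS] by (auto simp: j_def)
        then have "v i = w j" by (simp add: v t_def)
        then show False using wvz True w3x[OF iS] by (simp add: j_def)
      next
        case False
        then have "t (z j) = z j" using zj by (simp add: t_def)
        then have *: "v (z j) = t (w (z j))" by (simp add: v)
        have "w (z j) \<noteq> j" using False winj by (auto simp: j_def)
        then show False
          using * wvz w2x[OF zS] w3x[OF zS] by (cases "w (z j) = i") (auto simp: t_def j_def)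
      qed
    qed
    then have "z = id" using all jS zout zw by blast
    then show "w ^^ k = id" by (simp add: z_def)
  qed
qed

text \<open>Here \<open>s\<close> stands for the signs of a power of the group element, constant on
  the orbits of \<open>w\<close>. If \<open>s\<close> is not constant on \<open>S\<close>, then
  \<open>b\<close> is taken with \<open>s b\<close> different from \<open>s a\<close>, and the link
  from the orbit of \<open>a\<close> to \<open>b\<close> breaks invariance under
  \<open>v\<close>.\<close>

lemma exists_generic_conjugate:
  assumes S: "finite S" "w permutes S" and w2: "w \<circ> w \<noteq> id"
    and w3: "\<forall>i. S = orbit w i \<longrightarrow> w \<circ> w \<circ> w \<noteq> id"
    and sw: "\<forall>x\<in>S. s (w x) = s x"
  shows "\<exists>t. t permutes S \<and> (\<forall>v. v \<circ> t = t \<circ> w \<longrightarrow>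
    (\<forall>k. (w ^^ k) \<circ> v = v \<circ> (w ^^ k) \<longrightarrow> w ^^ k = id) \<and>
    ((\<forall>x\<in>S. s (v x) = s x) \<longrightarrow> (\<forall>x\<in>S. \<forall>y\<in>S. s x = s y)))"
proof -
  have self: "x \<in> orbit w x" for x
    using permutes_self_in_orbit S(1,2) by metis
  note eqI = permutes_orbit_eq[OF S(2,1)]
  have sorb: "s y = s x" if "y \<in> orbit w x" "x \<in> S" for x y
    using that(1)
  proof induction
    case base
    then show ?case using sw that(2) by blast
  next
    case (step y)
    then have "y \<in> S" using permutes_orbit_subset[OF S(2) that(2)] by blast
    then show ?case using bspec[OF sw, of y] step.IH by simp
  qed
  obtain a where a: "w a \<noteq> a" using w2 by (metis comp_apply eq_id_iff)
  then have aS: "a \<in> S" using S(2) permutes_not_in by metis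
  show ?thesis
  proof (cases "S = orbit w a")
    case True
    then have "s x = s a" if "x \<in> S" for x using sorb[OF _ aS, of x] that by blast
    then have "\<forall>x\<in>S. \<forall>y\<in>S. s x = s y" by metis
    then show ?thesis
      using conjugate_avoiding_powers_transitive[OF S True w2] w3 True by blast
  next
    case False
    then obtain c where c: "c \<in> S" "c \<notin> orbit w a"
      using permutes_orbit_subset[OF S(2) aS] by blast
    obtain b where b: "b \<in> S" "b \<notin> orbit w a" "s b = s a \<Longrightarrow> \<forall>x\<in>S. s x = s a"
    proof (cases "\<forall>x\<in>S. s x = s a")
      case True
      then show ?thesis using that c by blast
    next
      case False
      then obtain y where "y \<in> S" "s y \<noteq> s a" by blast
      then show ?thesis using that[of y] sorb[OF _ aS, of y] by blast
    qed
    have ia: "inv' w a \<in> S" using aS S(2) by (simp add: permutes_in_image permutes_inv)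
    have sia: "s (inv' w a) = s a" using bspec[OF sw ia] S(2) by (simp add: permutes_inverses)
    obtain t where t: "t permutes S" "\<And>v. v \<circ> t = t \<circ> w \<Longrightarrow> v (inv' w a) = b"
      "\<And>v k. v \<circ> t = t \<circ> w \<Longrightarrow> (w ^^ k) \<circ> v = v \<circ> (w ^^ k) \<Longrightarrow> w ^^ k = id"
      using conjugate_avoiding_powers_intransitive[OF S w2 aS b(1,2) a] by blast
    have "\<forall>x\<in>S. \<forall>y\<in>S. s x = s y" if "v \<circ> t = t \<circ> w" "\<forall>x\<in>S. s (v x) = s x" for v
    proof -
      have "s (v (inv' w a)) = s (inv' w a)" using that(2) ia by blast
      then have "s b = s a" by (simp only: sia t(2)[OF that(1)])
      then show ?thesis using b(3) by metis
    qed
    with t(1,3) show ?thesis by blast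
  qed
qed

section \<open>Cycle lengths and criteria for regularity\<close>

lemma card_orbit_eq_least_power:
  assumes "permutation f"
  shows "card (orbit f x) = least_power f x"
proof -
  let ?l = "least_power f x"
  have l: "(f ^^ ?l) x = x" "0 < ?l" using least_power_of_permutation[OF assms] by auto
  have "orbit f x = (\<lambda>m. (f ^^ m) x) ` {..<?l}"
    using orbit_altdef_bounded[OF l] by auto
  moreover have "inj_on (\<lambda>m. (f ^^ m) x) {..<?l}"
  proof (rule linorder_inj_onI)
    fix i j assume ij: "i < j" "i \<in> {..<?l}" "j \<in> {..<?l}"
    show "(f ^^ i) x \<noteq> (f ^^ j) x"
    proof
      assume "(f ^^ i) x = (f ^^ j) x"
      then have "(f ^^ i) ((f ^^ (j - i)) x) = (f ^^ i) x"
        using ij funpow_add[of i "j - i" f] by simp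
      then have "(f ^^ (j - i)) x = x"
        using inj_fn[OF bij_is_inj[OF permutation_bijective[OF assms]]] by (metis injD)
      then have "?l dvd j - i" by (rule least_power_minimal)
      then show False using ij by (auto dest: dvd_imp_le)
    qed
  qed auto
  ultimately show ?thesis by (simp add: card_image)
qed

lemma card_orbit_dvd:
  assumes "permutation f" "(f ^^ k) x = x"
  shows "card (orbit f x) dvd k"
  using assms by (simp add: card_orbit_eq_least_power least_power_minimal)

lemma funpow_card_orbit:
  assumes "permutation f"
  shows "(f ^^ card (orbit f x)) x = x"
  using assms by (simp add: card_orbit_eq_least_power least_power_of_permutation)

text \<open>All cycle lengths divide that of the cycle of \<open>x\<close>, which is therefore the
  maximum.\<close>

lemma regular_permutationI_orbit:
  assumes "finite S" "f permutes S" "x \<in> S"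
    and "\<And>z. z \<in> S \<Longrightarrow> (f ^^ card (orbit f x)) z = z"
  shows "regular_permutation S f"
proof -
  have f: "permutation f" using assms(1,2) permutation_permutes by blast
  let ?L = "cycle_lengths S f" and ?m = "card (orbit f x)"
  have m: "?m \<in> ?L" using assms(3) by (auto simp: cycle_lengths_def)
  have dvd: "l dvd ?m" if "l \<in> ?L" for l
    using that card_orbit_dvd[OF f assms(4)] by (auto simp: cycle_lengths_def)
  have "0 < ?m"
    using f by (simp add: card_orbit_eq_least_power least_power_of_permutation)
  then have "Max ?L = ?m"
    using m dvd assms(1) by (intro Max_eqI) (auto simp: cycle_lengths_def dest: dvd_imp_le)
  then show ?thesis using dvd assms(1,2) by (simp add: regular_permutation_def)
qed

text \<open>All cycle lengths are powers of \<open>p\<close>, hence totally ordered by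
  divisibility.\<close>

lemma regular_permutationI_prime_power:
  assumes "finite S" "f permutes S" "prime (p::nat)"
    and "\<And>x. x \<in> S \<Longrightarrow> (f ^^ (p ^ r)) x = x"
  shows "regular_permutation S f"
proof -
  have f: "permutation f" using assms(1,2) permutation_permutes by blast
  let ?L = "cycle_lengths S f"
  have fin: "finite ?L" using assms(1) by (simp add: cycle_lengths_def)
  have pow: "\<exists>i. l = p ^ i" if "l \<in> ?L" for l
    using that card_orbit_dvd[OF f assms(4)] divides_primepow_nat[OF assms(3)]
    unfolding cycle_lengths_def by blast
  have "l dvd Max ?L" if l: "l \<in> ?L" for l
  proof -
    have "Max ?L \<in> ?L" using l fin by (intro Max_in) auto
    then obtain i j where ij: "l = p ^ i" "Max ?L = p ^ j" using pow l by blast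
    then have "p ^ i \<le> p ^ j" using Max_ge[OF fin l] by simp
    then have "i \<le> j" using prime_gt_1_nat[OF assms(3)] by simp
    then show ?thesis using ij by (simp add: le_imp_power_dvd)
  qed
  then show ?thesis using assms(1,2) by (simp add: regular_permutation_def)
qed

section \<open>Conjugation quandles and powers of their right translations\<close>

context group
begin

lemma conj_conj:
  assumes "a \<in> carrier G" "b \<in> carrier G" "x \<in> carrier G"
  shows "a \<otimes> (b \<otimes> x \<otimes> inv b) \<otimes> inv a = (a \<otimes> b) \<otimes> x \<otimes> inv (a \<otimes> b)"
  using assms by (simp add: inv_mult_group m_assoc)

lemma conj_eq_iff_commute:
  assumes "g \<in> carrier G" "x \<in> carrier G"
  shows "g \<otimes> x \<otimes> inv g = x \<longleftrightarrow> g \<otimes> x = x \<otimes> g"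
  using assms by (metis inv_solve_right' m_closed)

lemma conjugacy_class_subset: "x \<in> carrier G \<Longrightarrow> conjugacy_class G x \<subseteq> carrier G"
  by (auto simp: conjugacy_class_def)

lemma conj_in_Union_conjugacy_classes:
  assumes "\<K> \<subseteq> conjugacy_classes G" "x \<in> \<Union>\<K>" "g \<in> carrier G"
  shows "g \<otimes> x \<otimes> inv g \<in> \<Union>\<K>"
proof -
  obtain c where c: "conjugacy_class G c \<in> \<K>" "x \<in> conjugacy_class G c" "c \<in> carrier G"
    using assms(1,2) by (auto simp: conjugacy_classes_def)
  then obtain h where h: "h \<in> carrier G" "x = h \<otimes> c \<otimes> inv h"
    by (auto simp: conjugacy_class_def)
  then have "g \<otimes> x \<otimes> inv g = (g \<otimes> h) \<otimes> c \<otimes> inv (g \<otimes> h)"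
    using conj_conj assms(3) c(3) by simp
  then have "g \<otimes> x \<otimes> inv g \<in> conjugacy_class G c"
    using h(1) assms(3) unfolding conjugacy_class_def by blast
  with c(1) show ?thesis by blast
qed

context
  fixes C
  assumes C: "C \<subseteq> carrier G" and closed: "\<And>g x. g \<in> carrier G \<Longrightarrow> x \<in> C \<Longrightarrow> g \<otimes> x \<otimes> inv g \<in> C"
begin

lemma conj_bij_betw:
  assumes y: "y \<in> carrier G"
  shows "bij_betw (\<lambda>x. y \<otimes> x \<otimes> inv y) C C"
proof (rule bij_betw_byWitness[where f' = "\<lambda>x. inv y \<otimes> x \<otimes> inv (inv y)"])
  show "\<forall>x\<in>C. inv y \<otimes> (y \<otimes> x \<otimes> inv y) \<otimes> inv (inv y) = x"
    using conj_conj[of "inv y" y] y C by auto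
  show "\<forall>x\<in>C. y \<otimes> (inv y \<otimes> x \<otimes> inv (inv y)) \<otimes> inv y = x"
    using conj_conj[of y "inv y"] y C by auto
qed (use closed[OF y] closed[OF inv_closed[OF y]] in auto)

lemma quandle_conj_quandle: "quandle (conj_quandle G C)"
proof
  fix x assume "x \<in> carrier (conj_quandle G C)"
  then show "x \<triangleright>\<^bsub>conj_quandle G C\<^esub> x = x"
    using C by (auto simp: conj_quandle_def m_assoc)
next
  fix y assume "y \<in> carrier (conj_quandle G C)"
  then show "bij_betw (\<lambda>x. x \<triangleright>\<^bsub>conj_quandle G C\<^esub> y) (carrier (conj_quandle G C))
      (carrier (conj_quandle G C))"
    using conj_bij_betw C by (auto simp: conj_quandle_def)
next
  fix x y z
  assume "x \<in> carrier (conj_quandle G C)" "y \<in> carrier (conj_quandle G C)"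
    "z \<in> carrier (conj_quandle G C)"
  then have xyz: "x \<in> carrier G" "y \<in> carrier G" "z \<in> carrier G"
    using C by (auto simp: conj_quandle_def)
  \<comment> \<open>Both sides of self-distributivity are conjugates of \<open>x\<close>, and this
    identifies the conjugating elements.\<close>
  have "z \<otimes> y \<otimes> inv z \<otimes> z = z \<otimes> y" using xyz by (simp add: m_assoc)
  then show "(x \<triangleright>\<^bsub>conj_quandle G C\<^esub> y) \<triangleright>\<^bsub>conj_quandle G C\<^esub> z =
      (x \<triangleright>\<^bsub>conj_quandle G C\<^esub> z) \<triangleright>\<^bsub>conj_quandle G C\<^esub> (y \<triangleright>\<^bsub>conj_quandle G C\<^esub> z)"
    using conj_conj[of z y x] conj_conj[of "z \<otimes> y \<otimes> inv z" z x] xyz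
    by (simp add: conj_quandle_def)
qed

lemma right_translation_conj_permutes:
  assumes "y \<in> C"
  shows "right_translation (conj_quandle G C) y permutes C"
proof (rule bij_imp_permutes)
  have "bij_betw (right_translation (conj_quandle G C) y) C C \<longleftrightarrow>
      bij_betw (\<lambda>x. y \<otimes> x \<otimes> inv y) C C"
    by (rule bij_betw_cong)
      (simp add: right_translation_def conj_quandle_def perm_restrict_simps)
  then show "bij_betw (right_translation (conj_quandle G C) y) C C"
    using conj_bij_betw assms C by blast
qed (simp add: right_translation_def conj_quandle_def perm_restrict_simps)

lemma right_translation_conj_funpow:
  assumes y: "y \<in> C" and x: "x \<in> C"
  shows "(right_translation (conj_quandle G C) y ^^ k) x = (y [^] k) \<otimes> x \<otimes> inv (y [^] k)"
proof (induction k)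
  case 0
  then show ?case using x C by auto
next
  case (Suc k)
  have "(y [^] k) \<otimes> x \<otimes> inv (y [^] k) \<in> C"
    using closed x y C by auto
  moreover have "y [^] Suc k = y \<otimes> y [^] k" using nat_pow_Suc2 y C by auto
  ultimately show ?case
    using Suc conj_conj[of y "y [^] k" x] x y C
    by (auto simp: right_translation_def conj_quandle_def perm_restrict_simps)
qed

text \<open>Cycle lengths thus become a question of which powers of \<open>y\<close> commute with
  which elements.\<close>

lemma right_translation_conj_funpow_eq_iff:
  assumes "y \<in> C" "x \<in> C"
  shows "(right_translation (conj_quandle G C) y ^^ k) x = x \<longleftrightarrow> y [^] k \<otimes> x = x \<otimes> y [^] k"
proof -
  have "y [^] k \<in> carrier G" "x \<in> carrier G" using assms C by auto
  then show ?thesis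
    by (simp only: right_translation_conj_funpow[OF assms] conj_eq_iff_commute)
qed

end

lemma nat_pow_involution:
  assumes "u \<in> carrier G" "u \<otimes> u = \<one>"
  shows "u [^] (j::nat) \<in> {\<one>, u}"
  using assms by (induction j) auto

end

section \<open>Groups of signed permutations and regularity of their translations\<close>

lemma nat_pow_sym_group: "p [^]\<^bsub>sym_group n\<^esub> k = p ^^ (k::nat)"
proof (induction k)
  case (Suc k)
  then show ?case by (simp add: sym_group_mult funpow_swap1 fun_eq_iff)
qed (simp add: sym_group_one)

text \<open>Covers types B and D at once: a group inside the wreath product that contains the
  permutations with trivial signs, which serve as conjugators.\<close>

locale signed_permutation_group = group G
  for G :: "((nat \<Rightarrow> int) \<times> (nat \<Rightarrow> nat)) monoid" (structure) and n :: nat +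
  assumes carrier_subset: "carrier G \<subseteq> sign_vectors n \<times> {p. p permutes {1..n}}"
    and mult_eq: "(a, \<pi>) \<otimes> (b, \<sigma>) = (\<lambda>i\<in>{1..n}. a i * b (inv' \<pi> i), \<pi> \<circ> \<sigma>)"
    and one_eq: "\<one> = (\<lambda>i\<in>{1..n}. 1, id)"
    and permutation_in_carrier: "t permutes {1..n} \<Longrightarrow> (\<lambda>i\<in>{1..n}. 1, t) \<in> carrier G"
begin

lemma finite_carrier: "finite (carrier G)"
  by (rule finite_subset[OF carrier_subset])
    (simp add: sign_vectors_def finite_PiE finite_permutations)

lemma snd_mult: "snd (x \<otimes> y) = snd x \<circ> snd y"
  by (cases x; cases y) (simp add: mult_eq)

lemma snd_pow: "snd (x [^] k) = snd x ^^ (k::nat)"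
proof (induction k)
  case (Suc k)
  then show ?case by (simp add: snd_mult funpow_swap1 fun_eq_iff)
qed (simp add: one_eq)

lemma sign_cases: "(a, \<pi>) \<in> carrier G \<Longrightarrow> i \<in> {1..n} \<Longrightarrow> a i = 1 \<or> a i = -1"
  using carrier_subset by (force simp: sign_vectors_def)

text \<open>Signs commute and are invertible, so \<open>b\<close> cancels and only the effect of
  \<open>\<sigma>\<close> on \<open>s\<close> is left.\<close>

lemma commute_sign_iff:
  assumes x: "(b, \<sigma>) \<in> carrier G"
  shows "(s, id) \<otimes> (b, \<sigma>) = (b, \<sigma>) \<otimes> (s, id) \<longleftrightarrow> (\<forall>i\<in>{1..n}. s (\<sigma> i) = s i)"
proof -
  have \<sigma>: "\<sigma> permutes {1..n}" using x carrier_subset by auto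
  have "(s, id) \<otimes> (b, \<sigma>) = (b, \<sigma>) \<otimes> (s, id) \<longleftrightarrow>
      (\<forall>i\<in>{1..n}. s i * b i = b i * s (inv' \<sigma> i))"
    by (auto simp: mult_eq fun_eq_iff restrict_def)
  also have "\<dots> \<longleftrightarrow> (\<forall>i\<in>{1..n}. s i = s (inv' \<sigma> i))"
    using sign_cases[OF x] by (intro ball_cong) force+
  also have "\<dots> \<longleftrightarrow> (\<forall>i\<in>\<sigma> ` {1..n}. s i = s (inv' \<sigma> i))"
    using permutes_image[OF \<sigma>] by simp
  also have "\<dots> \<longleftrightarrow> (\<forall>i\<in>{1..n}. s (\<sigma> i) = s i)"
    using permutes_inverses(2)[OF \<sigma>] by simp
  finally show ?thesis .
qed

lemma sign_square:
  assumes "(s, id) \<in> carrier G"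
  shows "(s, id) \<otimes> (s, id) = \<one>"
  using sign_cases[OF assms] by (force simp: mult_eq one_eq restrict_def fun_eq_iff)

text \<open>The source of central powers of \<open>y\<close>: a constant \<open>s\<close> is
  invariant under every permutation of the indices.\<close>

lemma constant_sign_commute:
  assumes "\<forall>i\<in>{1..n}. \<forall>j\<in>{1..n}. s i = s j" "x \<in> carrier G"
  shows "(s, id) \<otimes> x = x \<otimes> (s, id)"
proof (cases x)
  case (Pair b \<sigma>)
  then have "\<sigma> permutes {1..n}" using assms(2) carrier_subset by auto
  then show ?thesis
    using commute_sign_iff[of b \<sigma> s] assms Pair permutes_in_image[of \<sigma> "{1..n}"] by blast
qed

lemma regular_right_translation:
  assumes C: "C \<subseteq> carrier G" and closed: "\<And>g x. g \<in> carrier G \<Longrightarrow> x \<in> C \<Longrightarrow> g \<otimes> x \<otimes> inv g \<in> C"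
    and y: "y \<in> C"
  shows "regular_permutation C (right_translation (conj_quandle G C) y)"
proof -
  let ?f = "right_translation (conj_quandle G C) y" and ?S = "{1..n}"
  have fin: "finite C" using finite_carrier C finite_subset by blast
  have perm: "?f permutes C" using right_translation_conj_permutes[OF C closed y] .
  have fix_iff: "(?f ^^ k) x = x \<longleftrightarrow> y [^] k \<otimes> x = x \<otimes> y [^] k" if "x \<in> C" for x k
    using right_translation_conj_funpow_eq_iff[OF C closed y that] .
  have yG: "y \<in> carrier G" using y C by blast
  obtain a w where yaw: "y = (a, w)" by (cases y)
  have w: "w permutes ?S" using yG carrier_subset yaw by auto
  have pow: "\<exists>s. y [^] k = (s, id)" if "w ^^ k = id" for k :: nat
    using snd_pow[of y k] that yaw by (cases "y [^] k") auto
  \<comment> \<open>\<open>y [^] k\<close> commutes with \<open>y\<close>, whose permutation is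
    \<open>w\<close>.\<close>
  have inv_s: "\<forall>i\<in>?S. s (w i) = s i" if "y [^] k = (s, id)" for s and k :: nat
    using commute_sign_iff[of a w s] yG yaw that
    by (metis nat_pow_Suc nat_pow_Suc2)
  \<comment> \<open>The first two cases make the order of the translation divide 4 and 3; the last
    provides the hypotheses of \<open>exists_generic_conjugate\<close>.\<close>
  consider (two) "w \<circ> w = id" | (three) i where "?S = orbit w i" "w \<circ> w \<circ> w = id"
    | (generic) "w \<circ> w \<noteq> id" "\<forall>i. ?S = orbit w i \<longrightarrow> w \<circ> w \<circ> w \<noteq> id"
    by blast
  then show ?thesis
  proof cases
    case two
    then have "w ^^ 2 = id" by (simp add: numeral_2_eq_2)
    then obtain s where s: "y [^] (2::nat) = (s, id)" using pow by blast
    then have "(s, id) \<in> carrier G" using yG nat_pow_closed by metis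
    then have "y [^] (2::nat) \<otimes> y [^] (2::nat) = \<one>" using sign_square s by simp
    then have "y [^] ((2::nat) ^ 2) = \<one>" using nat_pow_mult[OF yG, of 2 2] by simp
    then have "(?f ^^ (2 ^ 2)) x = x" if "x \<in> C" for x
      using fix_iff[OF that] that C by auto
    then show ?thesis
      using regular_permutationI_prime_power[OF fin perm two_is_prime_nat] by blast
  next
    case three
    then have "w ^^ 3 = id" by (simp add: numeral_3_eq_3 comp_assoc)
    then obtain s where s: "y [^] (3::nat) = (s, id)" using pow by blast
    have iS: "i \<in> ?S" using permutes_self_in_orbit[OF w, of i] three(1) by simp
    \<comment> \<open>As \<open>w\<close> has a single orbit on the indices, the signs of the cube
      of \<open>y\<close> are constant and the cube is central.\<close>
    have "s j = s i" if "j \<in> orbit w i" for j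
      using that
    proof induction
      case base
      then show ?case using inv_s[OF s] iS by blast
    next
      case (step j)
      then show ?case using inv_s[OF s] three(1) by metis
    qed
    then have "s j = s i" if "j \<in> ?S" for j using that unfolding three(1) .
    then have "\<forall>i\<in>?S. \<forall>j\<in>?S. s i = s j" by metis
    then have "y [^] (3::nat) \<otimes> x = x \<otimes> y [^] (3::nat)" if "x \<in> C" for x
      unfolding s by (rule constant_sign_commute) (use that C in blast)
    then have "(?f ^^ (3 ^ 1)) x = x" if "x \<in> C" for x
      using fix_iff[OF that] that by simp
    then show ?thesis
      using regular_permutationI_prime_power[OF fin perm, of 3 1] by simp
  next
    case generic
    \<comment> \<open>The powers of \<open>y\<close> that are pure sign vectors are those with
      exponent divisible by \<open>d\<close>.\<close>
    define d where "d = group.ord (sym_group n) w"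
    have d: "w ^^ k = id \<longleftrightarrow> d dvd k" for k :: nat
      using group.pow_eq_id[OF sym_group_is_group, of w n k] w
      by (simp add: d_def nat_pow_sym_group sym_group_carrier sym_group_one)
    have "w ^^ d = id" using d by simp
    then obtain s where s: "y [^] d = (s, id)" using pow by blast
    have sG: "(s, id) \<in> carrier G" using nat_pow_closed[OF yG, of d] s by simp
    obtain t where t: "t permutes ?S"
      and t1: "\<And>v k. v \<circ> t = t \<circ> w \<Longrightarrow> (w ^^ k) \<circ> v = v \<circ> (w ^^ k) \<Longrightarrow> w ^^ k = id"
      and t2: "\<And>v. v \<circ> t = t \<circ> w \<Longrightarrow> \<forall>i\<in>?S. s (v i) = s i \<Longrightarrow> \<forall>i\<in>?S. \<forall>j\<in>?S. s i = s j"
      using exists_generic_conjugate[OF finite_atLeastAtMost w generic inv_s[OF s]] by blast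
    \<comment> \<open>Conjugation by \<open>g\<close> keeps \<open>y\<close> in \<open>C\<close> and
      conjugates its permutation \<open>w\<close> by \<open>t\<close>.\<close>
    define g where "g = (\<lambda>i\<in>?S. 1 :: int, t)"
    have g: "g \<in> carrier G" using permutation_in_carrier[OF t] by (simp add: g_def)
    define x where "x = g \<otimes> y \<otimes> inv g"
    have x: "x \<in> C" using closed[OF g y] by (simp add: x_def)
    then have xG: "x \<in> carrier G" using C by blast
    have "x \<otimes> g = g \<otimes> y" using g yG by (simp add: x_def m_assoc)
    then have v: "snd x \<circ> t = t \<circ> w" using snd_mult by (metis g_def snd_conv yaw)
    let ?L = "card (orbit ?f x)"
    have "(?f ^^ ?L) x = x"
      using funpow_card_orbit perm fin permutation_permutes by metis
    then have comm: "y [^] ?L \<otimes> x = x \<otimes> y [^] ?L" using fix_iff x by blast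
    \<comment> \<open>Projected to permutations, the commutation lets \<open>t1\<close> apply; hence
      \<open>y [^] ?L\<close> is a power of \<open>(s, id)\<close>, whose square is trivial.\<close>
    then have "(w ^^ ?L) \<circ> snd x = snd x \<circ> (w ^^ ?L)"
      using snd_mult snd_pow yaw by (metis snd_conv)
    then have "d dvd ?L" using t1[OF v] d by blast
    then obtain j where "?L = d * j" by blast
    then have "y [^] ?L = (s, id) [^] j" using nat_pow_pow[OF yG] s by metis
    then consider "y [^] ?L = \<one>" | "y [^] ?L = (s, id)"
      using nat_pow_involution[OF sG sign_square[OF sG], of j] by auto
    then have "y [^] ?L \<otimes> z = z \<otimes> y [^] ?L" if "z \<in> carrier G" for z
    proof cases
      case 1
      then show ?thesis using that by simp
    next
      case 2
      \<comment> \<open>Commuting with \<open>x\<close> makes \<open>s\<close> invariant under the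
        permutation of \<open>x\<close>; by the choice of \<open>t\<close>, such an \<open>s\<close>
        is constant.\<close>
      then have "\<forall>i\<in>?S. s (snd x i) = s i"
        using commute_sign_iff[of "fst x" "snd x" s] comm xG by simp
      then show ?thesis using constant_sign_commute[OF t2[OF v] that] 2 by simp
    qed
    then have "(?f ^^ ?L) z = z" if "z \<in> C" for z using fix_iff[OF that] that C by blast
    then show ?thesis by (intro regular_permutationI_orbit[OF fin perm x])
  qed
qed

lemma hayashi_conj_quandle:
  assumes "\<K> \<subseteq> conjugacy_classes G"
  shows "hayashi (conj_quandle G (\<Union>\<K>))"
proof -
  have C: "\<Union>\<K> \<subseteq> carrier G"
    using assms conjugacy_class_subset by (fastforce simp: conjugacy_classes_def)
  note closed = conj_in_Union_conjugacy_classes[OF assms]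
  have car: "carrier (conj_quandle G (\<Union>\<K>)) = \<Union>\<K>" by (simp add: conj_quandle_def)
  show ?thesis
    unfolding hayashi_def car
    using quandle_conj_quandle[OF C closed] finite_subset[OF C finite_carrier]
      regular_right_translation[OF C closed] by blast
qed

end

section \<open>The groups of types B and D as signed permutation groups\<close>

lemma mult_coxeter_B:
  "(a, \<pi>) \<otimes>\<^bsub>coxeter_B n\<^esub> (b, \<sigma>) = (\<lambda>i\<in>{1..n}. a i * b (inv' \<pi> i), \<pi> \<circ> \<sigma>)"
  by (simp add: coxeter_B_def wreath_C2_def sym_group_mult)

lemma one_coxeter_B: "\<one>\<^bsub>coxeter_B n\<^esub> = (\<lambda>i\<in>{1..n}. 1, id)"
  by (simp add: coxeter_B_def wreath_C2_def sym_group_one)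

lemma carrier_coxeter_B: "carrier (coxeter_B n) = sign_vectors n \<times> {p. p permutes {1..n}}"
  by (auto simp: coxeter_B_def wreath_C2_def sym_group_carrier)

lemma signed_permutation_group_coxeter_B: "signed_permutation_group (coxeter_B n) n"
proof -
  have "group (coxeter_B n)"
  proof (rule groupI)
    fix x y assume "x \<in> carrier (coxeter_B n)" "y \<in> carrier (coxeter_B n)"
    then obtain a \<pi> b \<sigma> where xy: "x = (a, \<pi>)" "y = (b, \<sigma>)" "a \<in> sign_vectors n"
      "b \<in> sign_vectors n" "\<pi> permutes {1..n}" "\<sigma> permutes {1..n}"
      by (auto simp: carrier_coxeter_B)
    have "a i * b (inv' \<pi> i) \<in> {1, -1}" if "i \<in> {1..n}" for i
    proof -
      have "inv' \<pi> i \<in> {1..n}"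
        using that permutes_in_image[OF permutes_inv[OF xy(5)]] by blast
      then have "a i \<in> {1, -1}" "b (inv' \<pi> i) \<in> {1, -1}"
        using xy(3,4) that unfolding sign_vectors_def by (blast dest: PiE_mem)+
      then show ?thesis by auto
    qed
    then show "x \<otimes>\<^bsub>coxeter_B n\<^esub> y \<in> carrier (coxeter_B n)"
      using xy(5,6)
      by (simp add: xy(1,2) mult_coxeter_B carrier_coxeter_B sign_vectors_def permutes_compose)
  next
    show "\<one>\<^bsub>coxeter_B n\<^esub> \<in> carrier (coxeter_B n)"
      by (simp add: one_coxeter_B carrier_coxeter_B sign_vectors_def permutes_id)
  next
    fix x y z
    assume "x \<in> carrier (coxeter_B n)" "y \<in> carrier (coxeter_B n)" "z \<in> carrier (coxeter_B n)"
    then obtain a \<pi> b \<sigma> c \<rho> where xyz: "x = (a, \<pi>)" "y = (b, \<sigma>)" "z = (c, \<rho>)"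
      "\<pi> permutes {1..n}" "\<sigma> permutes {1..n}"
      by (auto simp: carrier_coxeter_B)
    have "inv' (\<pi> \<circ> \<sigma>) = inv' \<sigma> \<circ> inv' \<pi>"
      using xyz by (intro o_inv_distrib permutes_bij)
    moreover have "inv' \<pi> i \<in> {1..n} \<longleftrightarrow> i \<in> {1..n}" for i
      using permutes_in_image[OF permutes_inv[OF xyz(4)]] .
    ultimately show "x \<otimes>\<^bsub>coxeter_B n\<^esub> y \<otimes>\<^bsub>coxeter_B n\<^esub> z = x \<otimes>\<^bsub>coxeter_B n\<^esub> (y \<otimes>\<^bsub>coxeter_B n\<^esub> z)"
      by (auto simp: xyz(1-3) mult_coxeter_B fun_eq_iff restrict_def mult.assoc)
  next
    fix x assume "x \<in> carrier (coxeter_B n)"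
    then obtain a \<pi> where x: "x = (a, \<pi>)" "a \<in> sign_vectors n" "\<pi> permutes {1..n}"
      by (auto simp: carrier_coxeter_B)
    show "\<one>\<^bsub>coxeter_B n\<^esub> \<otimes>\<^bsub>coxeter_B n\<^esub> x = x"
      \<comment> \<open>Elements are functions on all of \<open>nat\<close>, so the unit law rests
        on \<open>a\<close> being extensional.\<close>
      using PiE_restrict[OF x(2)[unfolded sign_vectors_def]]
      by (simp add: x(1) one_coxeter_B mult_coxeter_B cong: restrict_cong)
    have in_iff: "\<pi> i \<in> {1..n} \<longleftrightarrow> i \<in> {1..n}" for i by (rule permutes_in_image[OF x(3)])
    have a: "a i \<in> {1, -1}" if "i \<in> {1..n}" for i
      using x(2) that unfolding sign_vectors_def by (blast dest: PiE_mem)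
    \<comment> \<open>The left inverse: in the product with \<open>x\<close>, the sign at
      \<open>i\<close> is the square of \<open>a (\<pi> i)\<close>.\<close>
    let ?y = "(\<lambda>i\<in>{1..n}. a (\<pi> i), inv' \<pi>)"
    have "?y \<in> carrier (coxeter_B n)"
      using a in_iff permutes_inv[OF x(3)] by (simp add: carrier_coxeter_B sign_vectors_def)
    moreover have "a (\<pi> i) * a (\<pi> i) = 1" if "i \<in> {1..n}" for i
    proof -
      have "a (\<pi> i) \<in> {1, -1}" using that by (intro a) (simp only: in_iff)
      then show ?thesis by auto
    qed
    then have "?y \<otimes>\<^bsub>coxeter_B n\<^esub> x = \<one>\<^bsub>coxeter_B n\<^esub>"
      using permutes_inv_o[OF x(3)] permutes_inv_inv[OF x(3)]
      by (simp add: x(1) one_coxeter_B mult_coxeter_B restrict_def fun_eq_iff)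
    ultimately show "\<exists>y\<in>carrier (coxeter_B n). y \<otimes>\<^bsub>coxeter_B n\<^esub> x = \<one>\<^bsub>coxeter_B n\<^esub>" by blast
  qed
  then show ?thesis
    by (intro signed_permutation_group.intro signed_permutation_group_axioms.intro)
      (simp_all add: mult_coxeter_B one_coxeter_B carrier_coxeter_B sign_vectors_def)
qed

text \<open>The product of all signs is multiplicative, since reindexing by a permutation does not
  change it; its kernel \<open>H\<close> is thus a subgroup.\<close>

lemma signed_permutation_group_coxeter_D: "signed_permutation_group (coxeter_D n) n"
proof -
  interpret B: signed_permutation_group "coxeter_B n" n
    by (rule signed_permutation_group_coxeter_B)
  define H where "H = {(a, \<pi>) \<in> carrier (coxeter_B n). (\<Prod>i=1..n. a i) = 1}"
  have D: "coxeter_D n = (coxeter_B n)\<lparr>carrier := H\<rparr>" by (simp add: coxeter_D_def H_def)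
  have prod_inv: "(\<Prod>i=1..n. f (inv' \<pi> i)) = (\<Prod>i=1..n. f i)" if "\<pi> permutes {1..n}"
    for f :: "nat \<Rightarrow> int" and \<pi>
    using prod.permute[OF permutes_inv[OF that], of f] by (simp add: comp_def)
  have one: "\<one>\<^bsub>coxeter_B n\<^esub> \<in> H"
    using B.one_closed by (simp add: H_def one_coxeter_B)
  have mult: "x \<otimes>\<^bsub>coxeter_B n\<^esub> y \<in> H" if "x \<in> H" "y \<in> H" for x y
  proof -
    obtain a \<pi> b \<sigma> where xy: "x = (a, \<pi>)" "y = (b, \<sigma>)" by (cases x; cases y)
    then have "(\<Prod>i=1..n. a i) = 1" "(\<Prod>i=1..n. b i) = 1" and \<pi>: "\<pi> permutes {1..n}"
      using that by (simp_all add: H_def carrier_coxeter_B)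
    moreover have "x \<otimes>\<^bsub>coxeter_B n\<^esub> y \<in> carrier (coxeter_B n)"
      using that by (intro B.m_closed) (auto simp: H_def)
    ultimately show ?thesis
      using xy prod_inv[OF \<pi>, of b] by (simp add: H_def mult_coxeter_B prod.distrib)
  qed
  have "inv\<^bsub>coxeter_B n\<^esub> x \<in> H" if "x \<in> H" for x
  proof -
    have xB: "x \<in> carrier (coxeter_B n)" using that by (auto simp: H_def)
    obtain a \<pi> where x: "x = (a, \<pi>)" by (cases x)
    then have a: "(\<Prod>i=1..n. a i) = 1" using that by (simp add: H_def)
    obtain b \<sigma> where ix: "inv\<^bsub>coxeter_B n\<^esub> x = (b, \<sigma>)" by (cases "inv\<^bsub>coxeter_B n\<^esub> x")
    have ixB: "(b, \<sigma>) \<in> carrier (coxeter_B n)" using B.inv_closed[OF xB] ix by simp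
    then have \<sigma>: "\<sigma> permutes {1..n}" by (simp add: carrier_coxeter_B)
    \<comment> \<open>The left inverse law, multiplied over all indices, yields the product of
      \<open>b\<close> without a formula for the inverse.\<close>
    have "(b, \<sigma>) \<otimes>\<^bsub>coxeter_B n\<^esub> (a, \<pi>) = \<one>\<^bsub>coxeter_B n\<^esub>" using B.l_inv[OF xB] ix x by simp
    then have "(\<lambda>i\<in>{1..n}. b i * a (inv' \<sigma> i)) = (\<lambda>i\<in>{1..n}. 1)"
      by (simp add: mult_coxeter_B one_coxeter_B)
    from fun_cong[OF this] have "b i * a (inv' \<sigma> i) = 1" if "i \<in> {1..n}" for i
      unfolding restrict_def using that by meson
    then have "(\<Prod>i=1..n. b i * a (inv' \<sigma> i)) = 1" by simp
    then have "(\<Prod>i=1..n. b i) = 1"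
      using prod_inv[OF \<sigma>, of a] a by (simp add: prod.distrib)
    then show ?thesis using ixB ix by (simp add: H_def)
  qed
  then have "subgroup H (coxeter_B n)"
    using one mult by (intro B.subgroupI) (auto simp: H_def)
  then have "group (coxeter_D n)" unfolding D by (rule B.subgroup_imp_group)
  moreover have "H \<subseteq> carrier (coxeter_B n)" by (auto simp: H_def)
  moreover have "(\<lambda>i\<in>{1..n}. 1, t) \<in> H" if "t permutes {1..n}" for t
    using B.permutation_in_carrier[OF that] by (simp add: H_def)
  ultimately show ?thesis
    by (intro signed_permutation_group.intro signed_permutation_group_axioms.intro)
      (auto simp: D mult_coxeter_B one_coxeter_B carrier_coxeter_B)
qed

theorem theorem3p13:
  fixes n :: nat
    and G :: "((nat \<Rightarrow> int) \<times> (nat \<Rightarrow> nat)) monoid"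
    and C :: "((nat \<Rightarrow> int) \<times> (nat \<Rightarrow> nat)) set"
    and \<K> :: "((nat \<Rightarrow> int) \<times> (nat \<Rightarrow> nat)) set set"
  assumes "G = coxeter_B n \<or> G = coxeter_D n"
    and "\<K> \<subseteq> conjugacy_classes G"
    and "C = \<Union>\<K>"
  shows "hayashi (conj_quandle G C)"
  using assms signed_permutation_group.hayashi_conj_quandle
    signed_permutation_group_coxeter_B signed_permutation_group_coxeter_D by blast

end
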